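(* Let $q$ be a prime power and let $d\ge 2$ and $n\ge 1$ be integers. 1. If $n\le (d-1)d$ and $d$ does not divide $n$, then there is no polynomial $L=x^{q^d}-bx^q-ax$ with $a,b\in\mathbb{F}_{q^n}$ that splits completely over $\mathbb{F}_{q^n}$. 2. Let $n=id$ with $i\in\{1,\dots,d-1\}$, and let $L=x^{q^d}-bx^q-ax\in\mathbb{F}_{q^n}[x]$. Then $L$ has $q^d$ roots in $\mathbb{F}_{q^n}$ if and only if $a^{1+q^d+\dots+q^{(i-1)d}}=1$ and $b=0$. 3. Let $n=(d-1)d+1$, and let $L=x^{q^d}-bx^q-ax\in\mathbb{F}_{q^n}[x]$. Then $L$ has $q^d$ roots in $\mathbb{F}_{q^n}$ if and only if all of the following hold: (i) $N(a)=(-1)^{d-1}$, where $N(a)=a^{1+q+\dots+q^{(d-1)d}}=a^{(q^n-1)/(q-1)}$; (ii) $b=-a^{qe_1}$, where $e_1=\sum_{i=0}^{d-1}q^{id}$; (iii) $d-1$ is a power of the characteristic of $\mathbb{F}_{q^n}$.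
   Context: $\mathbb{F}_{q^n}$ denotes the finite field with $q^n$ elements. A polynomial $L=x^{q^d}-bx^q-ax\in\mathbb{F}_{q^n}[x]$ "splits completely over $\mathbb{F}_{q^n}$" means that $L$ has $q^d$ (distinct) roots in $\mathbb{F}_{q^n}$; equivalently, the $\mathbb{F}_q$-linear map $\mathbb{F}_{q^n}\to\mathbb{F}_{q^n}$, $x\mapsto L(x)$, has nullity $d$. "A power of the characteristic $p$" means $p^k$ for some integer $k\ge 0$ (so $1=p^0$ is included). *)

theory Defs
  imports
    "HOL-Computational_Algebra.Computational_Algebra"
    "HOL-Number_Theory.Prime_Powers"
begin

definition linearized_trinomial :: "nat \<Rightarrow> nat \<Rightarrow> 'a::field \<Rightarrow> 'a \<Rightarrow> 'a poly" where
  "linearized_trinomial q d a b = monom 1 (q ^ d) - monom b q - monom a 1"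

(* L is meant to have degree q ^ d; the condition counts distinct roots, and only those in
   the coefficient field itself. *)
definition splits_completely :: "nat \<Rightarrow> nat \<Rightarrow> 'a::field poly \<Rightarrow> bool" where
  "splits_completely q d L \<longleftrightarrow> card {x. poly L x = 0} = q ^ d"

end

theory Submission
  imports Defs
begin

text \<open>
  Let \<open>L = X ^ q ^ d - b X ^ q - a X\<close> over a field with \<open>q ^ n\<close> elements. All field elements are
  roots of \<open>X ^ q ^ n - X\<close>, so \<open>L\<close> splits completely if and only if \<open>X ^ q ^ n\<close> is congruent to
  \<open>X\<close> modulo \<open>L\<close>. Since \<open>X ^ q ^ (m + d)\<close> is congruent to
  \<open>b ^ q ^ m X ^ q ^ (m + 1) + a ^ q ^ m X ^ q ^ m\<close>, the remainder of \<open>X ^ q ^ m\<close> is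
  the sum over \<open>j < d\<close> of the \<open>c j m X ^ q ^ j\<close>, where \<open>c j\<close> solves the recurrence
  \<open>y (m + d) = a ^ q ^ m y m + b ^ q ^ m y (m + 1)\<close> and starts with a single \<open>1\<close> at place \<open>j\<close>. Thus
  \<open>L\<close> splits completely if and only if \<open>c 0 n = 1\<close> and \<open>c j n = 0\<close> for \<open>0 < j < d\<close>
  (lemma \<open>splits_completely_iff_impulse_period\<close>).

  The value \<open>c j n\<close> is a sum over descents from \<open>n\<close> to \<open>j\<close> with steps \<open>d\<close>, weighted by conjugates of
  \<open>a\<close>, and \<open>d - 1\<close>, weighted by conjugates of \<open>b\<close>. For \<open>n \<le> (d - 1) d + 1\<close> there are very few descents.
  If \<open>d\<close> does not divide \<open>n \<le> (d - 1) d\<close>, there is a unique descent to \<open>j = n mod d\<close>; it has long steps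
  only, so \<open>c j n\<close> is a power of \<open>a\<close> and vanishes only for \<open>a = 0\<close>; but \<open>a = 0\<close> is
  incompatible with \<open>c 0 n = 1\<close>. If \<open>n = i d\<close>
  with \<open>0 < i < d\<close>, the unique descent to \<open>i\<close> has short steps only, which forces \<open>b = 0\<close>, and the
  remaining condition on \<open>c 0 n\<close> is the one on \<open>a\<close>.

  For \<open>n = (d - 1) d + 1\<close>, the conditions on \<open>c 0 n\<close> and \<open>c 1 n\<close> together determine \<open>b\<close>
  as minus a product of conjugates of \<open>a\<close> (lemma \<open>period_determines_B\<close>). Once \<open>b\<close> has this form, a rescaling of the
  solutions turns the recurrence into \<open>z (m + d) = \<nu> (z m - z (m + 1))\<close>, where \<open>\<nu>\<close> is the norm of \<open>a\<close>
  (lemma \<open>gauge_to_constant_recurrence\<close>). With \<open>N = d - 1\<close> and the shift operator \<open>E\<close> this says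
  \<open>E ^ d = \<nu> (1 - E)\<close>, whence \<open>E ^ n = E (E ^ d) ^ N = \<nu> ^ N E (1 - E) ^ N\<close>. Replacing the top term, a
  multiple of \<open>E ^ d\<close>, once more by \<open>\<nu> (1 - E)\<close>, one sees that this operator is scalar on the solutions if and only
  if \<open>\<nu> = (- 1) ^ N\<close> and all binomial coefficients \<open>N choose k\<close> with \<open>0 < k < N\<close> vanish in the field,
  that is, if \<open>N\<close> is a power of the characteristic.
\<close>

section \<open>Solutions of a three-term recurrence\<close>

text \<open>
  With \<open>A m = a ^ q ^ m\<close> and \<open>B m = b ^ q ^ m\<close>, this is what the relation
  \<open>X ^ q ^ d = b X ^ q + a X\<close> becomes after raising it to the power \<open>q ^ m\<close>.
\<close>
definition trinomial_recurrence ::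
    "nat \<Rightarrow> (nat \<Rightarrow> 'a::comm_ring_1) \<Rightarrow> (nat \<Rightarrow> 'a) \<Rightarrow> (nat \<Rightarrow> 'a) \<Rightarrow> bool" where
  "trinomial_recurrence d A B y \<longleftrightarrow> (\<forall>m. y (m + d) = A m * y m + B m * y (m + 1))"

text \<open>
  The solution space of the recurrence has the sequences starting with a single nonzero value at
  \<open>j < d\<close> as a basis. The value \<open>e\<close> at \<open>j\<close> is left general because shifting the index by one turns
  the impulse at \<open>0\<close> into an impulse at \<open>d - 1\<close> of a different height.
\<close>
definition impulse_start :: "nat \<Rightarrow> nat \<Rightarrow> 'a::zero \<Rightarrow> (nat \<Rightarrow> 'a) \<Rightarrow> bool" where
  "impulse_start d j e y \<longleftrightarrow> (\<forall>m<d. y m = (if m = j then e else 0))"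

text \<open>
  The recurrence computes \<open>y (m + d)\<close> from \<open>y m\<close> and \<open>y (m + 1)\<close>; both lie strictly before
  \<open>m + d\<close> exactly because \<open>d \<ge> 2\<close>, so well-founded recursion provides a solution with any prescribed
  initial window \<open>{..<d}\<close>.
\<close>
lemma ex_impulse_solution:
  fixes A B :: "nat \<Rightarrow> 'a::comm_ring_1"
  assumes "d \<ge> 2"
  shows "\<exists>y. trinomial_recurrence d A B y \<and> impulse_start d j e y"
proof -
  define R where "R = (\<lambda>f m. if m < d then (if m = j then e else 0)
      else A (m - d) * f (m - d) + B (m - d) * f (m - d + 1))"
  define y where "y = wfrec less_than R"
  have "adm_wf less_than R"
    using assms by (auto simp: adm_wf_def R_def)
  then have unfold: "y m = R y m" for m
    unfolding y_def by (rule wfrec_fixpoint[OF wf_less_than, THEN fun_cong])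
  have "y (m + d) = A m * y m + B m * y (m + 1)" for m
    by (subst unfold) (simp add: R_def)
  moreover have "y m = (if m = j then e else 0)" if "m < d" for m
    using that by (subst unfold) (simp add: R_def)
  ultimately show ?thesis
    unfolding trinomial_recurrence_def impulse_start_def by (intro exI[of _ y] conjI allI impI)
qed

text \<open>
  The value at \<open>m\<close> is a sum over the descents from \<open>m\<close> to \<open>j\<close> with steps of length \<open>d\<close> (weight from
  \<open>A\<close>) and \<open>d - 1\<close> (weight from \<open>B\<close>). A descent with \<open>k\<close> steps, \<open>t\<close> of them short, covers the distance
  \<open>k * d - t\<close>, which requires \<open>t \<le> k\<close>. For \<open>k < t < d\<close> the distance \<open>k * d - t\<close> cannot be covered,
  since it would need \<open>k + l\<close> steps with \<open>t + l * d\<close> short ones for some integer \<open>l\<close>, which is a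
  negative number for \<open>l < 0\<close> and exceeds \<open>k + l\<close> for \<open>l \<ge> 0\<close>.
\<close>
lemma impulse_gap:
  assumes rec: "trinomial_recurrence d A B y" and start: "impulse_start d j e y"
    and "j < d" "k < t" "t < d" "t \<le> j + k * d"
  shows "y (j + k * d - t) = 0"
  using \<open>k < t\<close> \<open>t < d\<close> \<open>t \<le> j + k * d\<close>
proof (induction k arbitrary: t)
  case 0
  then show ?case
    using start \<open>j < d\<close> by (simp add: impulse_start_def)
next
  case (Suc k)
  show ?case
  proof (cases "t \<le> j + k * d")
    case True
    define m where "m = j + k * d - t"
    have "j + Suc k * d - t = m + d"
      using True by (simp add: m_def)
    then have "y (j + Suc k * d - t) = A m * y m + B m * y (m + 1)"
      using rec[unfolded trinomial_recurrence_def, rule_format, of m] by (simp only:)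
    moreover have "y m = 0"
      unfolding m_def using Suc.prems True by (intro Suc.IH) auto
    moreover have "m + 1 = j + k * d - (t - 1)"
      using Suc.prems True by (simp add: m_def)
    then have "y (m + 1) = 0"
      using Suc.IH[of "t - 1"] Suc.prems True by auto
    ultimately show ?thesis by simp
  next
    case False
    have "j + Suc k * d - t < d" using False \<open>j < d\<close> by simp
    moreover have "j + Suc k * d - t \<noteq> j"
    proof
      assume "j + Suc k * d - t = j"
      then have "Suc k * d = t" using Suc.prems by linarith
      then show False using \<open>t < d\<close> by simp
    qed
    ultimately show ?thesis
      using start by (simp add: impulse_start_def)
  qed
qed

text \<open>
  The distance \<open>k * (d - 1)\<close> with \<open>k < d\<close> is covered only by \<open>k\<close> short steps. The condition
  \<open>1 \<le> j\<close> makes the last of these steps legitimate: it starts at \<open>j + d - 1\<close>, which has to lie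
  outside the initial window.
\<close>
lemma impulse_diagonal:
  assumes rec: "trinomial_recurrence d A B y" and start: "impulse_start d j e y"
    and "1 \<le> j" "j < d" "k < d"
  shows "y (j + k * (d - 1)) = e * (\<Prod>s<k. B (j - 1 + s * (d - 1)))"
  using \<open>k < d\<close>
proof (induction k)
  case 0
  then show ?case
    using start \<open>j < d\<close> by (simp add: impulse_start_def)
next
  case (Suc k)
  define m where "m = j - 1 + k * (d - 1)"
  have "j + Suc k * (d - 1) = m + d"
    using \<open>1 \<le> j\<close> \<open>j < d\<close> by (simp add: m_def)
  then have "y (j + Suc k * (d - 1)) = A m * y m + B m * y (m + 1)"
    using rec by (simp only: trinomial_recurrence_def)
  moreover have "m = j + k * d - Suc k"
    using \<open>1 \<le> j\<close> \<open>j < d\<close> by (simp add: m_def diff_mult_distrib2 le_add_diff_inverse)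
  then have "y m = 0"
    using impulse_gap[OF rec start \<open>j < d\<close>, of k "Suc k"] Suc.prems \<open>1 \<le> j\<close>
    by (cases d) auto
  moreover have "m + 1 = j + k * (d - 1)"
    using \<open>1 \<le> j\<close> by (simp add: m_def)
  ultimately show ?case
    using Suc by (simp add: m_def mult_ac)
qed

text \<open>
  The distance \<open>k * d\<close> is covered only by \<open>k\<close> long steps as long as \<open>k < d - 1\<close>; for \<open>k = d - 1\<close>
  the descent with \<open>d\<close> short steps may occur in addition.
\<close>
lemma impulse_column:
  assumes rec: "trinomial_recurrence d A B y" and start: "impulse_start d j e y"
    and "j < d" "k + 2 \<le> d"
  shows "y (j + k * d) = e * (\<Prod>s<k. A (j + s * d))"
  using \<open>k + 2 \<le> d\<close>
proof (induction k)
  case 0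
  then show ?case
    using start \<open>j < d\<close> by (simp add: impulse_start_def)
next
  case (Suc k)
  define m where "m = j + k * d"
  have "j + Suc k * d = m + d"
    by (simp add: m_def)
  then have "y (j + Suc k * d) = A m * y m + B m * y (m + 1)"
    using rec by (simp only: trinomial_recurrence_def)
  moreover have "m + 1 = j + Suc k * d - (d - 1)"
    using \<open>j < d\<close> by (simp add: m_def)
  then have "y (m + 1) = 0"
    using impulse_gap[OF rec start \<open>j < d\<close>, of "Suc k" "d - 1"] Suc.prems by simp
  ultimately show ?case
    using Suc by (simp add: m_def mult_ac)
qed

text \<open>
  The last step down to \<open>0\<close> must be the long one from \<open>d\<close>, as the short one would start inside the
  initial window. Hence the impulse at \<open>0\<close> is, from index \<open>1\<close> on, an impulse of height \<open>A 0 * e\<close> at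
  the last place of the window \<open>{1..d}\<close>, and the diagonal formula applies to the shifted sequence.
\<close>
lemma impulse_zero_diagonal:
  assumes rec: "trinomial_recurrence d A B y" and start: "impulse_start d 0 e y"
    and "d \<ge> 2" "k < d"
  shows "y (d + k * (d - 1)) = A 0 * e * (\<Prod>s<k. B (Suc s * (d - 1)))"
proof -
  have "trinomial_recurrence d (\<lambda>m. A (m + 1)) (\<lambda>m. B (m + 1)) (\<lambda>m. y (m + 1))"
    unfolding trinomial_recurrence_def
  proof
    fix m
    have "y (m + 1 + d) = A (m + 1) * y (m + 1) + B (m + 1) * y (m + 1 + 1)"
      using rec unfolding trinomial_recurrence_def by blast
    then show "y (m + d + 1) = A (m + 1) * y (m + 1) + B (m + 1) * y (m + 1 + 1)"
      by (simp add: add_ac)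
  qed
  moreover have "y (0 + d) = A 0 * y 0 + B 0 * y (0 + 1)"
    using rec unfolding trinomial_recurrence_def by blast
  then have "y d = A 0 * e"
    using start \<open>d \<ge> 2\<close> by (simp add: impulse_start_def)
  then have "impulse_start d (d - 1) (A 0 * e) (\<lambda>m. y (m + 1))"
    unfolding impulse_start_def
  proof (intro allI impI)
    fix m assume "m < d"
    then show "y (m + 1) = (if m = d - 1 then A 0 * e else 0)"
      using start \<open>y d = A 0 * e\<close> by (cases "m = d - 1") (auto simp: impulse_start_def)
  qed
  ultimately have "y (d - 1 + k * (d - 1) + 1)
      = A 0 * e * (\<Prod>s<k. B (d - 1 - 1 + s * (d - 1) + 1))"
    using \<open>d \<ge> 2\<close> \<open>k < d\<close> by (intro impulse_diagonal) auto
  moreover have "d - 1 - 1 + s * (d - 1) + 1 = Suc s * (d - 1)" for s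
    using \<open>d \<ge> 2\<close> by simp
  moreover have "d - 1 + k * (d - 1) + 1 = d + k * (d - 1)"
    using \<open>d \<ge> 2\<close> by simp
  ultimately show ?thesis by (simp only:)
qed

section \<open>Reduction to constant coefficients\<close>

text \<open>
  In terms of the shift operator \<open>E\<close> the hypothesis is \<open>E ^ d = \<nu> (1 - E)\<close>, so
  \<open>E ^ (k * d) = \<nu> ^ k (1 - E) ^ k\<close>, and the binomial theorem applies.
\<close>
lemma constant_recurrence_multistep:
  fixes z :: "nat \<Rightarrow> 'a::comm_ring_1"
  assumes rec: "\<And>m. z (m + d) = \<nu> * (z m - z (m + 1))"
  shows "z (m + k * d) = \<nu> ^ k * (\<Sum>i\<le>k. of_nat (k choose i) * (- 1) ^ i * z (m + i))"
proof (induction k arbitrary: m)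
  case 0
  then show ?case by simp
next
  case (Suc k)
  let ?S = "\<lambda>m. \<Sum>i\<le>k. of_nat (k choose i) * (- 1) ^ i * z (m + i)"
  have "z (m + Suc k * d) = z (m + k * d + d)"
    by (simp add: add_ac)
  also have "\<dots> = \<nu> * (z (m + k * d) - z (m + 1 + k * d))"
    using rec[of "m + k * d"] by (simp add: add_ac)
  also have "\<dots> = \<nu> ^ Suc k * (?S m - ?S (m + 1))"
    by (simp only: Suc.IH) (simp add: algebra_simps)
  also have "?S m - ?S (m + 1)
      = (\<Sum>i\<le>Suc k. of_nat (Suc k choose i) * (- 1) ^ i * z (m + i))"
  proof -
    \<comment> \<open>Pascal's rule; the extra term \<open>i = k + 1\<close> added to the first sum has coefficient \<open>k choose (k + 1) = 0\<close>.\<close>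
    have "?S m = (\<Sum>i\<le>Suc k. of_nat (k choose i) * (- 1) ^ i * z (m + i))"
      by (simp add: binomial_eq_0)
    also have "\<dots> = z m + (\<Sum>i\<le>k. of_nat (k choose Suc i) * (- 1) ^ Suc i * z (m + Suc i))"
      by (subst sum.atMost_Suc_shift) simp
    finally have "?S m - ?S (m + 1) = z m
        + (\<Sum>i\<le>k. of_nat (Suc k choose Suc i) * (- 1) ^ Suc i * z (m + Suc i))"
      by (simp add: algebra_simps sum.distrib sum_negf sum_subtractf)
    then show ?thesis
      by (subst sum.atMost_Suc_shift) simp
  qed
  finally show ?case .
qed

text \<open>
  Taking \<open>k = N\<close> and \<open>m = 1\<close> above expresses \<open>z (N * (N + 1) + 1)\<close> by \<open>z 1, \<dots>, z (N + 1)\<close>; the last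
  of these, which is the term with \<open>i = N\<close>, lies outside the initial window and is rewritten as
  \<open>\<nu> (z 0 - z 1)\<close>.
\<close>
lemma constant_recurrence_period:
  fixes z :: "nat \<Rightarrow> 'a::comm_ring_1"
  assumes rec: "\<And>m. z (m + (N + 1)) = \<nu> * (z m - z (m + 1))" and "N \<ge> 1"
  shows "z (N * (N + 1) + 1) = \<nu> ^ N * ((- 1) ^ N * \<nu> * z 0 + (1 - (- 1) ^ N * \<nu>) * z 1
     + (\<Sum>k = 1..<N. of_nat (N choose k) * (- 1) ^ k * z (k + 1)))"
proof -
  have "{..N} = insert 0 (insert N {1..<N})"
    using \<open>N \<ge> 1\<close> by auto
  then have "(\<Sum>i\<le>N. of_nat (N choose i) * (- 1) ^ i * z (1 + i))
      = z 1 + (- 1) ^ N * z (0 + (N + 1))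
        + (\<Sum>k = 1..<N. of_nat (N choose k) * (- 1) ^ k * z (k + 1))"
    using \<open>N \<ge> 1\<close> by (simp add: add.commute)
  also have "z (0 + (N + 1)) = \<nu> * (z 0 - z 1)"
    using rec[of 0] by simp
  finally have sum: "(\<Sum>i\<le>N. of_nat (N choose i) * (- 1) ^ i * z (1 + i))
      = (- 1) ^ N * \<nu> * z 0 + (1 - (- 1) ^ N * \<nu>) * z 1
        + (\<Sum>k = 1..<N. of_nat (N choose k) * (- 1) ^ k * z (k + 1))"
    by (simp add: algebra_simps)
  have "z (1 + N * (N + 1)) = \<nu> ^ N * (\<Sum>i\<le>N. of_nat (N choose i) * (- 1) ^ i * z (1 + i))"
    by (rule constant_recurrence_multistep) (rule rec)
  then show ?thesis
    unfolding sum by (simp only: add.commute)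
qed

lemma prod_period:
  fixes A :: "nat \<Rightarrow> 'a::comm_monoid_mult"
  assumes per: "\<And>m. A (m + n) = A m"
  shows "(\<Prod>i<n. A (m + i)) = (\<Prod>i<n. A i)"
proof (induction m)
  case 0
  then show ?case by simp
next
  case (Suc m)
  have "(\<Prod>i<n. A (Suc m + i)) = (\<Prod>i<n. A (m + i))"
  proof (cases n)
    case (Suc l)
    have "(\<Prod>i<n. A (m + i)) = A m * (\<Prod>i<l. A (Suc m + i))"
      unfolding Suc by (subst prod.lessThan_Suc_shift) simp
    moreover have "(\<Prod>i<n. A (Suc m + i)) = (\<Prod>i<l. A (Suc m + i)) * A m"
      using per[of m] unfolding Suc by simp
    ultimately show ?thesis by (simp add: mult.commute)
  qed simp
  then show ?case using Suc by simp
qed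

lemma prod_blocks:
  fixes A :: "nat \<Rightarrow> 'a::comm_monoid_mult"
  shows "(\<Prod>r<d. \<Prod>i<N. A (r + i * d)) = (\<Prod>v<N * d. A v)"
proof -
  have "(\<Prod>v<N * d. A v) = (\<Prod>i<N. \<Prod>v = i * d..<i * d + d. A v)"
    by (rule prod.nat_group[symmetric])
  also have "\<dots> = (\<Prod>i<N. \<Prod>r<d. A (r + i * d))"
  proof (rule prod.cong)
    fix i
    show "(\<Prod>v = i * d..<i * d + d. A v) = (\<Prod>r<d. A (r + i * d))"
      by (rule prod.reindex_bij_witness[of _ "\<lambda>r. r + i * d" "\<lambda>v. v - i * d"]) auto
  qed simp
  also have "\<dots> = (\<Prod>r<d. \<Prod>i<N. A (r + i * d))"
    by (rule prod.swap)
  finally show ?thesis ..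
qed

text \<open>
  If \<open>B\<close> is given by \<open>A\<close> through the stated product, then the variable coefficients can be absorbed
  into a rescaling \<open>z m = y m / g m\<close>. For \<open>z\<close> to satisfy the recurrence
  \<open>z (m + d) = \<nu> (z m - z (m + 1))\<close> one needs \<open>A m = \<nu> g (m + d) / g m\<close> and
  \<open>B m = - \<nu> g (m + d) / g (m + 1)\<close>. Dividing the two equations forces \<open>g (m + 1) / g m = - A m / B m\<close>,
  which defines \<open>g\<close>. By the shape of \<open>B\<close> this ratio is the inverse of the product
  \<open>h m\<close> of the \<open>A (m + 1 + i * d)\<close> with \<open>i < N\<close>. The ratio \<open>g (m + d) / g m\<close> is then the inverse of
  the product of \<open>A\<close> over the \<open>n - 1\<close> places after \<open>m\<close>, that is \<open>A m / \<nu>\<close>, because \<open>\<nu>\<close> is the product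
  over any full period.
\<close>
lemma gauge_to_constant_recurrence:
  fixes A B :: "nat \<Rightarrow> 'a::field"
  assumes d: "d = N + 1" and n: "n = N * d + 1"
    and per: "\<And>m. A (m + n) = A m" and nz: "\<And>m. A m \<noteq> 0"
    and B: "\<And>m. B m = - (\<Prod>i<d. A (m + 1 + i * d))"
    and \<nu>: "\<nu> = (\<Prod>v<n. A v)"
  shows "\<exists>g. g 0 = 1 \<and> (\<forall>m. g m \<noteq> 0) \<and> \<nu> ^ N * g n = 1 \<and>
     (\<forall>y. trinomial_recurrence d A B y \<longrightarrow>
        (\<forall>m. y (m + d) / g (m + d) = \<nu> * (y m / g m - y (m + 1) / g (m + 1))))"
proof -
  define h where "h m = (\<Prod>i<N. A (m + 1 + i * d))" for m
  define g where "g m = inverse (\<Prod>s<m. h s)" for m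
  have h_nz: "h m \<noteq> 0" for m
    using nz by (simp add: h_def)
  have g_nz: "g m \<noteq> 0" for m
    using h_nz by (simp add: g_def)
  have "\<nu> \<noteq> 0"
    using nz by (simp add: \<nu>)
  have g_Suc: "g (m + 1) * h m = g m" for m
    using h_nz by (simp add: g_def)
  have B_eq: "B m = - (A m * h m)" for m
    using per[of m] by (simp add: B d n h_def mult.commute add_ac)
  \<comment> \<open>The blocks \<open>r + i * d\<close> with \<open>r < d\<close>, \<open>i < N\<close> fill the \<open>n - 1\<close> places after \<open>m\<close>.\<close>
  have block: "(\<Prod>r<d. h (m + r)) * A m = \<nu>" for m
  proof -
    have "(\<Prod>r<d. h (m + r)) = (\<Prod>r<d. \<Prod>i<N. A (m + 1 + (r + i * d)))"
      by (simp add: h_def add_ac)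
    also have "\<dots> = (\<Prod>v<N * d. A (m + 1 + v))"
      by (rule prod_blocks[of "\<lambda>v. A (m + 1 + v)"])
    finally have "(\<Prod>r<d. h (m + r)) * A m = (\<Prod>v<n. A (m + v))"
      unfolding n by (simp only: Suc_eq_plus1[symmetric] prod.lessThan_Suc_shift) (simp add: mult.commute)
    then show ?thesis
      using prod_period[of A n m, OF per] by (simp add: \<nu>)
  qed
  have g_shift: "g (m + d) * \<nu> = A m * g m" for m
  proof -
    have "(\<Prod>s<m + d. h s) = (\<Prod>s<m. h s) * (\<Prod>r<d. h (m + r))"
      by (induction d) (simp_all add: mult_ac)
    then have "g (m + d) * (\<Prod>r<d. h (m + r)) = g m"
      using h_nz by (simp add: g_def)
    then show ?thesis
      by (metis block mult.assoc mult.commute)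
  qed
  \<comment> \<open>Walking from \<open>1\<close> to \<open>n\<close> in \<open>N\<close> steps of length \<open>d\<close> collects exactly the factors of \<open>h 0\<close>, and
    \<open>g 1 * h 0 = g 0 = 1\<close>.\<close>
  have "g (1 + k * d) * \<nu> ^ k = g 1 * (\<Prod>s<k. A (1 + s * d))" for k
  proof (induction k)
    case (Suc k)
    have "g (1 + Suc k * d) * \<nu> ^ Suc k = (g (1 + k * d + d) * \<nu>) * \<nu> ^ k"
      by (simp add: add_ac mult_ac)
    also have "\<dots> = A (1 + k * d) * g (1 + k * d) * \<nu> ^ k"
      by (simp only: g_shift)
    also have "\<dots> = A (1 + k * d) * (g (1 + k * d) * \<nu> ^ k)"
      by (rule mult.assoc)
    also have "g (1 + k * d) * \<nu> ^ k = g 1 * (\<Prod>s<k. A (1 + s * d))"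
      by (rule Suc.IH)
    finally show ?case
      by (simp only: prod.lessThan_Suc mult_ac)
  qed simp
  from this[of N] have "\<nu> ^ N * g n = g (0 + 1) * h 0"
    by (simp add: n h_def mult.commute)
  then have "\<nu> ^ N * g n = 1"
    by (simp only: g_Suc) (simp add: g_def)
  moreover have "y (m + d) / g (m + d) = \<nu> * (y m / g m - y (m + 1) / g (m + 1))"
    if "trinomial_recurrence d A B y" for y m
  proof -
    have "y (m + d) = A m * y m - A m * h m * y (m + 1)"
      using that by (simp add: trinomial_recurrence_def B_eq)
    moreover have "g (m + d) = A m * g m / \<nu>"
      using g_shift[of m] \<open>\<nu> \<noteq> 0\<close> by (simp add: field_simps)
    ultimately have "y (m + d) / g (m + d)
        = (A m * y m - A m * h m * y (m + 1)) / (A m * g m / \<nu>)"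
      by simp
    also have "\<dots> = \<nu> * (y m / g m - y (m + 1) / (g m / h m))"
      using nz[of m] h_nz[of m] g_nz[of m] \<open>\<nu> \<noteq> 0\<close> by (simp add: field_simps)
    also have "g m / h m = g (m + 1)"
      using g_Suc[of m] h_nz[of m] by (simp add: field_simps)
    finally show ?thesis .
  qed
  ultimately show ?thesis
    using g_nz by (intro exI[of _ g]) (auto simp: g_def)
qed

text \<open>
  The factor \<open>\<nu> ^ N\<close> coming from the constant recurrence cancels against \<open>g n\<close>, so that the coefficient
  of \<open>y 0\<close> does not involve \<open>g\<close>.
\<close>
lemma solution_after_period:
  fixes A B :: "nat \<Rightarrow> 'a::field"
  assumes d: "d = N + 1" and n: "n = N * d + 1" and "N \<ge> 1"
    and per: "\<And>m. A (m + n) = A m" and nz: "\<And>m. A m \<noteq> 0"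
    and B: "\<And>m. B m = - (\<Prod>i<d. A (m + 1 + i * d))"
    and \<nu>: "\<nu> = (\<Prod>v<n. A v)"
  obtains g :: "nat \<Rightarrow> 'a" where "\<And>m. g m \<noteq> 0" and
    "\<And>y. trinomial_recurrence d A B y \<Longrightarrow>
        y n = (- 1) ^ N * \<nu> * y 0 + (1 - (- 1) ^ N * \<nu>) * (y 1 / g 1)
          + (\<Sum>k = 1..<N. of_nat (N choose k) * (- 1) ^ k * (y (k + 1) / g (k + 1)))"
proof -
  obtain g where g: "g 0 = 1" "\<And>m. g m \<noteq> 0" "\<nu> ^ N * g n = 1"
    and rec: "\<And>y m. trinomial_recurrence d A B y \<Longrightarrow>
        y (m + d) / g (m + d) = \<nu> * (y m / g m - y (m + 1) / g (m + 1))"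
    using gauge_to_constant_recurrence[OF d n per nz B \<nu>] by blast
  show thesis
  proof (rule that)
    fix y assume y: "trinomial_recurrence d A B y"
    have "y n / g n = \<nu> ^ N * ((- 1) ^ N * \<nu> * (y 0 / g 0)
        + (1 - (- 1) ^ N * \<nu>) * (y 1 / g 1)
        + (\<Sum>k = 1..<N. of_nat (N choose k) * (- 1) ^ k * (y (k + 1) / g (k + 1))))"
      unfolding n d by (rule constant_recurrence_period) (use rec[OF y] \<open>N \<ge> 1\<close> d in auto)
    then have "y n = (\<nu> ^ N * g n) * ((- 1) ^ N * \<nu> * (y 0 / g 0)
        + (1 - (- 1) ^ N * \<nu>) * (y 1 / g 1)
        + (\<Sum>k = 1..<N. of_nat (N choose k) * (- 1) ^ k * (y (k + 1) / g (k + 1))))"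
      using g(2)[of n] by (simp add: field_simps)
    then show "y n = (- 1) ^ N * \<nu> * y 0 + (1 - (- 1) ^ N * \<nu>) * (y 1 / g 1)
        + (\<Sum>k = 1..<N. of_nat (N choose k) * (- 1) ^ k * (y (k + 1) / g (k + 1)))"
      by (simp add: g(1,3))
  qed (rule g(2))
qed

section \<open>Binomial coefficients and the characteristic\<close>

text \<open>
  Write \<open>N = p ^ e * m\<close> with \<open>p\<close> not dividing \<open>m\<close>. By the Frobenius map
  \<open>(X + 1) ^ N = (X ^ p ^ e + 1) ^ m\<close>, whose coefficient at \<open>p ^ e\<close> is \<open>m\<close>, hence nonzero. So if all
  inner binomial coefficients vanish, \<open>p ^ e\<close> cannot be an inner index and \<open>m = 1\<close>; conversely, for
  \<open>m = 1\<close> the right-hand side has no inner terms.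
\<close>
lemma binomials_vanish_iff_CHAR_power:
  assumes "N \<ge> 1"
  shows "(\<forall>k\<in>{1..<N}. of_nat (N choose k) = (0 :: 'a::field_prime_char))
    \<longleftrightarrow> (\<exists>e. N = CHAR('a) ^ e)"
proof -
  define p where "p = CHAR('a)"
  have "prime p" by (simp add: p_def)
  obtain e m where m: "N = p ^ e * m" "\<not> p dvd m"
    using \<open>N \<ge> 1\<close> \<open>prime p\<close> multiplicity_decompose'[of N p]
    by (metis not_one_le_zero not_prime_unit)
  have "m > 0" "p ^ e > 0"
    using \<open>N \<ge> 1\<close> \<open>prime p\<close> m by (auto simp: prime_gt_0_nat)
  have "(monom 1 1 + 1 :: 'a poly) ^ N = ((monom 1 1 + 1) ^ (p ^ e)) ^ m"
    by (simp add: m(1) power_mult)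
  also have "(monom 1 1 + 1 :: 'a poly) ^ (p ^ e) = monom 1 (p ^ e) + 1"
    using freshmans_dream'[of "p ^ e" e "monom 1 1 :: 'a poly" 1] by (simp add: p_def monom_power)
  also have "\<dots> ^ m = (\<Sum>i\<le>m. monom (of_nat (m choose i)) (p ^ e * i))"
    by (subst binomial_ring) (simp add: monom_power of_nat_poly smult_monom)
  moreover have "(monom 1 1 + 1 :: 'a poly) ^ N = (\<Sum>i\<le>N. monom (of_nat (N choose i)) i)"
    by (subst binomial_ring) (simp add: monom_power of_nat_poly smult_monom)
  ultimately have eq: "(\<Sum>i\<le>N. monom (of_nat (N choose i) :: 'a) i)
      = (\<Sum>i\<le>m. monom (of_nat (m choose i)) (p ^ e * i))"
    by simp
  have coeff_eq: "of_nat (N choose k)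
      = (\<Sum>i\<le>m. if p ^ e * i = k then of_nat (m choose i) else (0 :: 'a))" if "k \<le> N" for k
    using arg_cong[OF eq, of "\<lambda>f. coeff f k"] that by (simp add: coeff_sum)
  show ?thesis
  proof
    assume van: "\<forall>k\<in>{1..<N}. of_nat (N choose k) = (0 :: 'a)"
    have "of_nat (N choose p ^ e) = (of_nat m :: 'a)"
      using coeff_eq[of "p ^ e"] \<open>m > 0\<close> prime_gt_0_nat[OF \<open>prime p\<close>] by (simp add: m(1))
    also have "\<dots> \<noteq> 0"
      using m(2) by (simp add: of_nat_eq_0_iff_char_dvd p_def)
    finally have "p ^ e \<notin> {1..<N}"
      using van by blast
    then have "N = p ^ e"
      using \<open>m > 0\<close> \<open>p ^ e > 0\<close> m(1) by auto
    then show "\<exists>e. N = CHAR('a) ^ e"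
      by (auto simp: p_def)
  next
    assume "\<exists>e. N = CHAR('a) ^ e"
    then obtain f where "N = p ^ f"
      by (auto simp: p_def)
    then have "m dvd p ^ f" using m(1) by (metis dvd_triv_right)
    then obtain i where "m = p ^ i"
      using \<open>prime p\<close> divides_primepow_nat by blast
    then have "m = 1"
      using m(2) by (cases i) auto
    then show "\<forall>k\<in>{1..<N}. of_nat (N choose k) = (0 :: 'a)"
      using coeff_eq m(1) by auto
  qed
qed

section \<open>Splitting as periodicity of a recurrence\<close>

text \<open>
  Translation by \<open>1\<close> permutes the field, so summing all elements shows that the cardinality is zero in
  the field. Hence the characteristic is a prime that divides \<open>q ^ n\<close>, and \<open>q\<close> has only one prime divisor.
\<close>
lemma CHAR_power_if_card_power:
  assumes "primepow q" "card (UNIV :: 'a::finite_field set) = q ^ n"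
  shows "\<exists>e. q = CHAR('a) ^ e"
proof -
  have "(\<Sum>x\<in>(UNIV :: 'a set). x + 1) = (\<Sum>x\<in>UNIV. x)"
    by (rule sum.reindex_bij_witness[of _ "\<lambda>x. x - 1" "\<lambda>x. x + 1"]) auto
  then have "of_nat (q ^ n) = (0 :: 'a)"
    using assms(2) by (simp add: sum.distrib)
  then have "CHAR('a) dvd q ^ n"
    by (simp only: of_nat_eq_0_iff_char_dvd)
  then have "CHAR('a) dvd q"
    using CHAR_prime prime_dvd_power by blast
  moreover obtain p k where "prime p" "q = p ^ k"
    using assms(1) by (auto simp: primepow_def)
  ultimately have "CHAR('a) dvd p"
    using CHAR_prime[where ?'a = 'a] prime_dvd_power by blast
  then have "CHAR('a) = p"
    using \<open>prime p\<close> CHAR_prime[where ?'a = 'a] primes_dvd_imp_eq by blast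
  then show ?thesis
    using \<open>q = p ^ k\<close> by blast
qed

text \<open>
  Reduction of \<open>X ^ q ^ m\<close> modulo the trinomial. Raising polynomials to the power \<open>q ^ k\<close> is
  additive, so modulo the trinomial \<open>X ^ q ^ (k + d)\<close> is the combination of \<open>X ^ q ^ k\<close> and
  \<open>X ^ q ^ (k + 1)\<close> with coefficients \<open>a ^ q ^ k\<close> and \<open>b ^ q ^ k\<close>; the remainders therefore obey the
  trinomial recurrence in each coefficient.
\<close>
lemma linearized_trinomial_dvd_power_reduction:
  fixes a b :: "'a::finite_field"
  assumes q: "q = CHAR('a) ^ e" and "d \<ge> 2"
    and rec: "\<And>j. j < d \<Longrightarrow> trinomial_recurrence d (\<lambda>m. a ^ q ^ m) (\<lambda>m. b ^ q ^ m) (c j)"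
    and start: "\<And>j. j < d \<Longrightarrow> impulse_start d j 1 (c j)"
  shows "linearized_trinomial q d a b dvd monom 1 (q ^ m) - (\<Sum>j<d. monom (c j m) (q ^ j))"
    (is "?L dvd ?X m - ?S m")
proof (induction m rule: less_induct)
  case (less m)
  show ?case
  proof (cases "m < d")
    case True
    have "?S m = (\<Sum>j<d. if j = m then monom 1 (q ^ m) else 0)"
      using start True by (intro sum.cong) (auto simp: impulse_start_def)
    then show ?thesis using True by simp
  next
    case False
    define k where "k = m - d"
    have m: "m = k + d" and "k < m" "k + 1 < m"
      using False \<open>d \<ge> 2\<close> by (auto simp: k_def)
    have smult_sum: "smult u (\<Sum>j<d. f j) = (\<Sum>j<d. smult u (f j))"
      for u :: 'a and f :: "nat \<Rightarrow> 'a poly"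
      by (induction d) (simp_all add: smult_add_right)
    have frob: "(f + g) ^ q ^ k = f ^ q ^ k + g ^ q ^ k" for f g :: "'a poly"
      by (rule freshmans_dream'[of _ "e * k"]) (auto simp: q power_mult)
    have "(?X d - monom b q - monom a 1) ^ q ^ k + (monom b q + monom a 1) ^ q ^ k = ?X d ^ q ^ k"
      by (subst frob[symmetric]) simp
    then have "?L ^ q ^ k = ?X m - monom (b ^ q ^ k) (q ^ (k + 1)) - monom (a ^ q ^ k) (q ^ k)"
      by (simp add: frob monom_power m linearized_trinomial_def algebra_simps power_add)
    moreover have "q > 0"
      by (simp add: q prime_gt_0_nat)
    then have "?L dvd ?L ^ q ^ k"
      by (intro dvd_power) auto
    ultimately have L: "?L dvd ?X m - monom (b ^ q ^ k) (q ^ (k + 1)) - monom (a ^ q ^ k) (q ^ k)"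
      by simp
    have "?S m = (\<Sum>j<d. smult (a ^ q ^ k) (monom (c j k) (q ^ j))
        + smult (b ^ q ^ k) (monom (c j (k + 1)) (q ^ j)))"
    proof (intro sum.cong refl)
      fix j assume "j \<in> {..<d}"
      then have "c j m = a ^ q ^ k * c j k + b ^ q ^ k * c j (k + 1)"
        using rec[of j] unfolding trinomial_recurrence_def m by blast
      then show "monom (c j m) (q ^ j) = smult (a ^ q ^ k) (monom (c j k) (q ^ j))
        + smult (b ^ q ^ k) (monom (c j (k + 1)) (q ^ j))"
        by (simp add: smult_monom add_monom)
    qed
    also have "\<dots> = smult (a ^ q ^ k) (?S k) + smult (b ^ q ^ k) (?S (k + 1))"
      by (simp add: sum.distrib smult_sum)
    finally have "?X m - ?S m
      = (?X m - monom (b ^ q ^ k) (q ^ (k + 1)) - monom (a ^ q ^ k) (q ^ k))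
        + smult (a ^ q ^ k) (?X k - ?S k) + smult (b ^ q ^ k) (?X (k + 1) - ?S (k + 1))"
      by (simp add: smult_diff_right smult_monom)
    then show ?thesis
      by (simp only:) (intro dvd_add dvd_smult L less.IH[OF \<open>k < m\<close>] less.IH[OF \<open>k + 1 < m\<close>])
  qed
qed

text \<open>
  Every field element is a root of \<open>X ^ q ^ n - X\<close>. Let \<open>S\<close> be the remainder of \<open>X ^ q ^ n\<close> modulo the
  trinomial \<open>L\<close>. If \<open>L\<close> has \<open>q ^ d\<close> roots in the field, then \<open>S - X\<close> vanishes at all of them although its
  degree is smaller, so \<open>S = X\<close>. Conversely, if \<open>S = X\<close>, then \<open>L\<close> divides the polynomial
  \<open>X ^ q ^ n - X\<close>, which has as many roots as its degree, and so does every divisor of it.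
\<close>
lemma splits_completely_iff_impulse_period:
  fixes a b :: "'a::finite_field"
  assumes q: "q = CHAR('a) ^ e" "q \<ge> 2" and "d \<ge> 2"
    and card: "card (UNIV :: 'a set) = q ^ n"
    and rec: "\<And>j. j < d \<Longrightarrow> trinomial_recurrence d (\<lambda>m. a ^ q ^ m) (\<lambda>m. b ^ q ^ m) (c j)"
    and start: "\<And>j. j < d \<Longrightarrow> impulse_start d j 1 (c j)"
  shows "splits_completely q d (linearized_trinomial q d a b)
    \<longleftrightarrow> (\<forall>j<d. c j n = (if j = 0 then 1 else 0))"
proof -
  define L where "L = linearized_trinomial q d a b"
  define S where "S = (\<Sum>j<d. monom (c j n) (q ^ j))"
  have roots_UNIV: "poly (monom 1 (q ^ n)) x = x" for x :: 'a
    using finite_field_power_card_eq_same[of x] by (simp add: poly_monom card)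
  have "L dvd monom 1 (q ^ n) - S"
    unfolding L_def S_def
    by (rule linearized_trinomial_dvd_power_reduction) (use assms in auto)
  have "q ^ 1 < q ^ d" "1 < q ^ d"
    using \<open>q \<ge> 2\<close> \<open>d \<ge> 2\<close> by (auto simp only: power_strict_increasing_iff intro!: one_less_power)
  have "degree L = q ^ d"
  proof -
    have "degree (- monom b q - monom a 1) \<le> q"
      by (intro degree_diff_le) (use \<open>q \<ge> 2\<close> in \<open>auto intro: order.trans[OF degree_monom_le]\<close>)
    then have "degree (- monom b q - monom a 1) < degree (monom (1::'a) (q ^ d))"
      using \<open>q ^ 1 < q ^ d\<close> by (simp add: degree_monom_eq)
    then have "degree (monom 1 (q ^ d) + (- monom b q - monom a 1)) = q ^ d"
      by (subst degree_add_eq_left) (simp_all add: degree_monom_eq)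
    then show ?thesis by (simp add: L_def linearized_trinomial_def algebra_simps)
  qed
  have coeff_S: "coeff S (q ^ j) = c j n" if "j < d" for j
    using that \<open>q \<ge> 2\<close> by (simp add: S_def coeff_sum power_inject_exp)
  have S_eq_iff: "S = monom 1 1 \<longleftrightarrow> (\<forall>j<d. c j n = (if j = 0 then 1 else 0))"
  proof
    assume "S = monom 1 1"
    moreover have "q ^ j = 1 \<longleftrightarrow> j = 0" for j
      using \<open>q \<ge> 2\<close> by (cases j) auto
    ultimately show "\<forall>j<d. c j n = (if j = 0 then 1 else 0)"
      using coeff_S by (metis coeff_monom)
  next
    assume *: "\<forall>j<d. c j n = (if j = 0 then 1 else 0)"
    have "S = (\<Sum>j<d. if j = 0 then monom 1 1 else 0)"
      unfolding S_def using * by (intro sum.cong) auto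
    then show "S = monom 1 1" using \<open>d \<ge> 2\<close> by simp
  qed
  have "card {x. poly L x = 0} = q ^ d \<longleftrightarrow> S = monom 1 1"
  proof
    assume split: "card {x. poly L x = 0} = q ^ d"
    have "{x. poly L x = 0} \<subseteq> {x. poly (S - monom 1 1) x = 0}"
    proof safe
      fix x assume "poly L x = 0"
      moreover obtain K where "monom 1 (q ^ n) - S = L * K"
        using \<open>L dvd _\<close> by (rule dvdE)
      ultimately have "poly (monom 1 (q ^ n) - S) x = 0"
        by simp
      then show "poly (S - monom 1 1) x = 0"
        using roots_UNIV[of x] by (simp add: poly_monom)
    qed
    then have "q ^ d \<le> card {x. poly (S - monom 1 1) x = 0}"
      using card_mono split by (metis finite)
    moreover have "degree (S - monom 1 1) < q ^ d"
    proof (rule degree_diff_less)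
      show "degree S < q ^ d"
        unfolding S_def using \<open>q \<ge> 2\<close>
        by (intro degree_sum_less) (auto intro: le_less_trans[OF degree_monom_le])
      show "degree (monom (1::'a) 1) < q ^ d"
        using \<open>1 < q ^ d\<close> by (simp add: degree_monom_eq)
    qed
    ultimately show "S = monom 1 1"
      using card_poly_roots_bound[of "S - monom 1 1"] by fastforce
  next
    assume "S = monom 1 1"
    then obtain M where M: "monom 1 (q ^ n) - monom 1 1 = L * M"
      using \<open>L dvd _\<close> by (auto elim!: dvdE)
    have "n > 0"
    proof (rule ccontr)
      assume "\<not> n > 0"
      then have "card (UNIV :: 'a set) = 1" using card by simp
      moreover have "card {0, 1 :: 'a} \<le> card (UNIV :: 'a set)"
        by (intro card_mono) auto
      ultimately show False by simp
    qed
    then have "1 < q ^ n" using \<open>q \<ge> 2\<close> by (intro one_less_power) auto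
    then have "degree (monom 1 (q ^ n) + - monom 1 1 :: 'a poly) = q ^ n"
      by (subst degree_add_eq_left) (simp_all add: degree_monom_eq)
    then have deg: "degree (monom 1 (q ^ n) - monom 1 1 :: 'a poly) = q ^ n"
      by simp
    then have "L * M \<noteq> 0"
      using M \<open>1 < q ^ n\<close> by (metis degree_0 not_less_zero)
    then have "q ^ n = q ^ d + degree M"
      using deg M \<open>degree L = q ^ d\<close> by (simp add: degree_mult_eq)
    moreover have "q ^ n \<le> card ({x. poly L x = 0} \<union> {x. poly M x = 0})"
    proof -
      have "poly (L * M) x = 0" for x
        unfolding M[symmetric] using roots_UNIV[of x] by (simp add: poly_monom)
      then have "{x. poly L x = 0} \<union> {x. poly M x = 0} = UNIV" by auto
      then show ?thesis using card by simp
    qed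
    moreover have "card {x. poly L x = 0} \<le> q ^ d" "card {x. poly M x = 0} \<le> degree M"
      using card_poly_roots_bound \<open>L * M \<noteq> 0\<close> \<open>degree L = q ^ d\<close> by (metis mult_eq_0_iff)+
    moreover note card_Un_le[of "{x. poly L x = 0}" "{x. poly M x = 0}"]
    ultimately show "card {x. poly L x = 0} = q ^ d" by linarith
  qed
  then show ?thesis
    unfolding splits_completely_def L_def[symmetric] S_eq_iff .
qed

section \<open>Periodicity for short periods\<close>

text \<open>
  The last step of a descent to \<open>0\<close> is the long one from \<open>d\<close>, so every such descent has weight zero.
\<close>
lemma impulse_vanishes_if_A_zero:
  assumes rec: "trinomial_recurrence d A B y" and start: "impulse_start d 0 e y"
    and "d \<ge> 2" and A: "\<And>m. A m = 0" and "m \<ge> 1"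
  shows "y m = 0"
  using \<open>m \<ge> 1\<close>
proof (induction m rule: less_induct)
  case (less m)
  show ?case
  proof (cases "m < d")
    case True
    then show ?thesis using start less.prems by (simp add: impulse_start_def)
  next
    case False
    then have "y (m - d + d) = A (m - d) * y (m - d) + B (m - d) * y (m - d + 1)"
      using rec unfolding trinomial_recurrence_def by blast
    moreover have "y (m - d + 1) = 0"
      using False \<open>d \<ge> 2\<close> by (intro less.IH) auto
    ultimately show ?thesis
      using False A by simp
  qed
qed

lemma binomial_recurrence_solution:
  assumes rec: "trinomial_recurrence d A (\<lambda>_. 0) y"
  shows "y (k * d) = (\<Prod>s<k. A (s * d)) * y 0"
proof (induction k)
  case (Suc k)
  have "y (k * d + d) = A (k * d) * y (k * d)"
    using rec by (simp add: trinomial_recurrence_def)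
  then show ?case
    using Suc by (simp add: add.commute mult_ac)
qed simp

section \<open>Periodicity for the extremal period\<close>

text \<open>
  For \<open>n = N * d + 1\<close> the only descent from \<open>n\<close> to \<open>0\<close> has \<open>N\<close> short steps and then a long one, while
  there are two descents from \<open>n\<close> to \<open>1\<close>: one with \<open>N\<close> long and one with \<open>d\<close> short steps. The two
  periodicity conditions share the product of the \<open>B (s * N)\<close> with \<open>1 \<le> s \<le> N\<close>, and eliminating it
  leaves \<open>B 0\<close> in terms of \<open>A\<close>.
\<close>
lemma period_determines_B:
  fixes A B :: "nat \<Rightarrow> 'a::field"
  assumes d: "d = N + 1" and n: "n = N * d + 1" and "N \<ge> 1"
    and per: "A n = A 0"
    and rec: "\<And>j. j < d \<Longrightarrow> trinomial_recurrence d A B (c j)"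
    and start: "\<And>j. j < d \<Longrightarrow> impulse_start d j 1 (c j)"
    and period: "c 0 n = 1" "c 1 n = 0"
  shows "A 0 \<noteq> 0" "B 0 = - (\<Prod>i<d. A (1 + i * d))"
proof -
  have "n = d + N * (d - 1)"
    by (simp add: n d)
  then have c0: "A 0 * (\<Prod>s<N. B (Suc s * N)) = 1"
    using impulse_zero_diagonal[OF rec[of 0] start[of 0], of N] period(1) \<open>N \<ge> 1\<close> by (simp add: d)
  then show "A 0 \<noteq> 0" by auto
  \<comment> \<open>From \<open>n\<close>, the long step leads to \<open>N * N\<close> and the short step to \<open>N * N + 1\<close>.\<close>
  have m: "N * N = 1 + (N - 1) * d"
    using \<open>N \<ge> 1\<close> by (cases N) (simp_all add: d)
  have "c 1 (N * N + d) = A (N * N) * c 1 (N * N) + B (N * N) * c 1 (N * N + 1)"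
    using rec[of 1] \<open>N \<ge> 1\<close> d unfolding trinomial_recurrence_def by simp
  moreover have "N * N + d = n"
    by (simp add: n d)
  moreover have "c 1 (N * N) = (\<Prod>s<N - 1. A (1 + s * d))"
    using impulse_column[OF rec[of 1] start[of 1], of "N - 1"] \<open>N \<ge> 1\<close> unfolding m by (simp add: d)
  moreover have "c 1 (N * N + 1) = (\<Prod>s<N. B (s * N))"
    using impulse_diagonal[OF rec[of 1] start[of 1], of N] \<open>N \<ge> 1\<close> by (simp add: d)
  ultimately have "A (N * N) * (\<Prod>s<N - 1. A (1 + s * d)) + (\<Prod>s<Suc N. B (s * N)) = 0"
    using period(2) by (simp add: mult.commute)
  moreover have "A (N * N) * (\<Prod>s<N - 1. A (1 + s * d)) = (\<Prod>s<N. A (1 + s * d))"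
    using m prod.lessThan_Suc[of "\<lambda>s. A (1 + s * d)" "N - 1"] \<open>N \<ge> 1\<close> by (simp add: mult.commute)
  moreover have "(\<Prod>s<Suc N. B (s * N)) = B 0 * (\<Prod>s<N. B (Suc s * N))"
    by (subst prod.lessThan_Suc_shift) simp
  ultimately have "B 0 * (\<Prod>s<N. B (Suc s * N)) = - (\<Prod>s<N. A (1 + s * d))"
    by (simp add: eq_neg_iff_add_eq_0 add.commute)
  then have "B 0 * (A 0 * (\<Prod>s<N. B (Suc s * N))) = - ((\<Prod>s<N. A (1 + s * d)) * A 0)"
    by (simp add: mult_ac)
  moreover have "A 0 = A (1 + N * d)"
    using per by (simp add: n)
  ultimately show "B 0 = - (\<Prod>i<d. A (1 + i * d))"
    unfolding c0 d by simp
qed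

text \<open>
  Evaluating the formula for the value after one period on the impulse at \<open>j\<close>: for \<open>j = 0\<close> it gives
  \<open>(- 1) ^ N * \<nu>\<close>, for \<open>j = 1\<close> a nonzero multiple of \<open>1 - (- 1) ^ N * \<nu>\<close>, and for \<open>j = k + 1\<close> with
  \<open>1 \<le> k < N\<close> a nonzero multiple of the binomial coefficient. So the condition on the norm and the
  condition on the binomial coefficients come from different \<open>j\<close>.
\<close>
lemma impulse_period_iff:
  fixes A B :: "nat \<Rightarrow> 'a::field"
  assumes d: "d = N + 1" and n: "n = N * d + 1" and "N \<ge> 1"
    and per: "\<And>m. A (m + n) = A m" and nz: "\<And>m. A m \<noteq> 0"
    and B: "\<And>m. B m = - (\<Prod>i<d. A (m + 1 + i * d))"
    and rec: "\<And>j. j < d \<Longrightarrow> trinomial_recurrence d A B (c j)"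
    and start: "\<And>j. j < d \<Longrightarrow> impulse_start d j 1 (c j)"
  shows "(\<forall>j<d. c j n = (if j = 0 then 1 else 0)) \<longleftrightarrow>
    (\<Prod>v<n. A v) = (- 1) ^ N \<and> (\<forall>k\<in>{1..<N}. of_nat (N choose k) = (0 :: 'a))"
proof -
  define \<nu> where "\<nu> = (\<Prod>v<n. A v)"
  obtain g where g: "\<And>m. g m \<noteq> 0" and sol: "\<And>y. trinomial_recurrence d A B y \<Longrightarrow>
        y n = (- 1) ^ N * \<nu> * y 0 + (1 - (- 1) ^ N * \<nu>) * (y 1 / g 1)
          + (\<Sum>k = 1..<N. of_nat (N choose k) * (- 1) ^ k * (y (k + 1) / g (k + 1)))"
    using solution_after_period[OF d n \<open>N \<ge> 1\<close> per nz B \<nu>_def] by blast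
  have sol_c: "c j n = (- 1) ^ N * \<nu> * c j 0 + (1 - (- 1) ^ N * \<nu>) * (c j 1 / g 1)
          + (\<Sum>k = 1..<N. of_nat (N choose k) * (- 1) ^ k * (c j (k + 1) / g (k + 1)))"
    if "j < d" for j
    using sol rec that by blast
  have c: "c j m = (if m = j then 1 else 0)" if "j < d" "m < d" for j m
    using start that by (auto simp: impulse_start_def)
  have "c 0 n = (- 1) ^ N * \<nu>"
    using \<open>N \<ge> 1\<close> by (subst sol_c) (auto simp: d c intro!: sum.neutral)
  moreover have "c 1 n = (1 - (- 1) ^ N * \<nu>) / g 1"
    using \<open>N \<ge> 1\<close> by (subst sol_c) (auto simp: d c intro!: sum.neutral)
  moreover have "c (k + 1) n = of_nat (N choose k) * (- 1) ^ k / g (k + 1)"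
    if "k \<in> {1..<N}" for k
  proof -
    have "(\<Sum>i = 1..<N. of_nat (N choose i) * (- 1) ^ i * (c (k + 1) (i + 1) / g (i + 1)))
      = (\<Sum>i = 1..<N. if i = k then of_nat (N choose k) * (- 1) ^ k / g (k + 1) else 0)"
      using that by (intro sum.cong) (auto simp: c d)
    then show ?thesis
      using that by (subst sol_c) (auto simp: d c)
  qed
  moreover have "(- 1) ^ N * \<nu> = 1 \<longleftrightarrow> \<nu> = (- 1) ^ N"
    by (cases "even N") (auto simp: minus_equation_iff)
  moreover have "(\<forall>j<d. P j) \<longleftrightarrow> P 0 \<and> P 1 \<and> (\<forall>k\<in>{1..<N}. P (k + 1))" for P
  proof -
    have "{j. j < d} = insert 0 (insert 1 ((\<lambda>k. k + 1) ` {1..<N}))"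
      using \<open>N \<ge> 1\<close> unfolding d by (auto simp: image_iff)
    then have "(\<forall>j<d. P j) \<longleftrightarrow> (\<forall>j\<in>insert 0 (insert 1 ((\<lambda>k. k + 1) ` {1..<N})). P j)"
      by (metis (no_types, lifting) mem_Collect_eq)
    then show ?thesis
      by (simp only: ball_simps)
  qed
  ultimately show ?thesis
    using g by (simp add: \<nu>_def)
qed

section \<open>Trinomials that split completely\<close>

text \<open>
  The product formula for \<open>B 0 = b\<close> is necessary by the impulses at \<open>0\<close> and \<open>1\<close>; by the Frobenius map
  it then holds at every index, and the rescaled recurrence decides the rest.
\<close>
lemma splits_completely_extremal_iff:
  fixes a b :: "'a::finite_field"
  assumes q: "q = CHAR('a) ^ e" "q \<ge> 2" and card: "card (UNIV :: 'a set) = q ^ n"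
    and d: "d = N + 1" and n: "n = N * d + 1" and "N \<ge> 1"
  shows "splits_completely q d (linearized_trinomial q d a b) \<longleftrightarrow>
    (\<Prod>v<n. a ^ q ^ v) = (- 1) ^ N \<and> b = - (\<Prod>i<d. a ^ q ^ (1 + i * d)) \<and> (\<exists>k. N = CHAR('a) ^ k)"
proof -
  define A where "A m = a ^ q ^ m" for m
  define B where "B m = b ^ q ^ m" for m
  have "d \<ge> 2" using d \<open>N \<ge> 1\<close> by simp
  obtain c where rec: "\<And>j. trinomial_recurrence d A B (c j)"
    and start: "\<And>j. impulse_start d j 1 (c j)"
    using ex_impulse_solution[OF \<open>d \<ge> 2\<close>, of A B _ 1] by metis
  have split_iff: "splits_completely q d (linearized_trinomial q d a b)
      \<longleftrightarrow> (\<forall>j<d. c j n = (if j = 0 then 1 else 0))"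
    by (rule splits_completely_iff_impulse_period[OF q \<open>d \<ge> 2\<close> card])
      (use rec start in \<open>auto simp: A_def[abs_def] B_def[abs_def]\<close>)
  have per: "A (m + n) = A m" for m
    using finite_field_power_card_eq_same[of "a ^ q ^ m"]
    by (simp add: A_def power_add power_mult card)
  have B_formula: "B m = - (\<Prod>i<d. A (m + 1 + i * d))" if b: "b = - (\<Prod>i<d. A (1 + i * d))" for m
  proof -
    \<comment> \<open>Additivity of the Frobenius map gives \<open>(- x) ^ q ^ m = - (x ^ q ^ m)\<close> for even \<open>q\<close> as well.\<close>
    have "((- x) + x) ^ q ^ m = (- x) ^ q ^ m + x ^ q ^ m" for x :: 'a
      by (rule freshmans_dream'[of _ "e * m"]) (auto simp: q power_mult)
    then have "(- x) ^ q ^ m = - (x ^ q ^ m)" for x :: 'a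
      using \<open>q \<ge> 2\<close> by (simp add: eq_neg_iff_add_eq_0)
    then show ?thesis
      by (simp add: B_def b A_def add_ac mult_ac power_add prod_power_distrib flip: power_mult)
  qed
  have iff: "(\<forall>j<d. c j n = (if j = 0 then 1 else 0)) \<longleftrightarrow>
      (\<Prod>v<n. A v) = (- 1) ^ N \<and> (\<exists>k. N = CHAR('a) ^ k)"
    if "a \<noteq> 0" "b = - (\<Prod>i<d. A (1 + i * d))"
    using impulse_period_iff[OF d n \<open>N \<ge> 1\<close> per _ B_formula[OF that(2)] rec start] that(1)
      binomials_vanish_iff_CHAR_power[OF \<open>N \<ge> 1\<close>, where ?'a = 'a]
    by (simp add: A_def)
  show ?thesis
    unfolding split_iff A_def[symmetric]
  proof
    assume L: "\<forall>j<d. c j n = (if j = 0 then 1 else 0)"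
    have "A 0 \<noteq> 0" "B 0 = - (\<Prod>i<d. A (1 + i * d))"
      using period_determines_B[OF d n \<open>N \<ge> 1\<close> _ rec start] per[of 0] L \<open>d \<ge> 2\<close> by simp_all
    then show "(\<Prod>v<n. A v) = (- 1) ^ N \<and> b = - (\<Prod>i<d. A (1 + i * d)) \<and> (\<exists>k. N = CHAR('a) ^ k)"
      using iff L by (simp add: A_def B_def)
  next
    assume R: "(\<Prod>v<n. A v) = (- 1) ^ N \<and> b = - (\<Prod>i<d. A (1 + i * d)) \<and> (\<exists>k. N = CHAR('a) ^ k)"
    have "a \<noteq> 0"
    proof
      assume "a = 0"
      then have "(\<Prod>v<n. A v) = 0"
        using \<open>q \<ge> 2\<close> n by (intro prod_zero) (auto simp: A_def)
      then show False using R by simp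
    qed
    then show "\<forall>j<d. c j n = (if j = 0 then 1 else 0)"
      using iff R by blast
  qed
qed

text \<open>
  From \<open>n = i * d = i + i * (d - 1)\<close> the impulse at \<open>i\<close> is reached only by \<open>i\<close> short steps, so its value
  at \<open>n\<close> is a power of \<open>b\<close>. As \<open>i \<noteq> 0\<close>, this value has to vanish, which forces \<open>b = 0\<close>; then only
  long steps remain.
\<close>
lemma splits_completely_multiple_iff:
  fixes a b :: "'a::finite_field"
  assumes q: "q = CHAR('a) ^ e" "q \<ge> 2" and card: "card (UNIV :: 'a set) = q ^ (i * d)"
    and "d \<ge> 2" "1 \<le> i" "i < d"
  shows "splits_completely q d (linearized_trinomial q d a b) \<longleftrightarrow>
    (\<Prod>s<i. a ^ q ^ (s * d)) = 1 \<and> b = 0"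
proof -
  define A where "A m = a ^ q ^ m" for m
  define B where "B m = b ^ q ^ m" for m
  obtain c where rec: "\<And>j. trinomial_recurrence d A B (c j)"
    and start: "\<And>j. impulse_start d j 1 (c j)"
    using ex_impulse_solution[OF \<open>d \<ge> 2\<close>, of A B _ 1] by metis
  have split_iff: "splits_completely q d (linearized_trinomial q d a b)
      \<longleftrightarrow> (\<forall>j<d. c j (i * d) = (if j = 0 then 1 else 0))"
    by (rule splits_completely_iff_impulse_period[OF q \<open>d \<ge> 2\<close> card])
      (use rec start in \<open>auto simp: A_def[abs_def] B_def[abs_def]\<close>)
  have "i + i * (d - 1) = i * d"
    using \<open>d \<ge> 2\<close> by (simp add: diff_mult_distrib2)
  then have "c i (i * d) = (\<Prod>s<i. B (i - 1 + s * (d - 1)))"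
    using impulse_diagonal[OF rec start \<open>1 \<le> i\<close> \<open>i < d\<close> \<open>i < d\<close>] by simp
  then have b: "b = 0" if "c i (i * d) = 0"
    using that by (auto simp: B_def)
  have c: "c j (i * d) = (\<Prod>s<i. A (s * d)) * (if j = 0 then 1 else 0)" if "b = 0" "j < d" for j
  proof -
    have "B = (\<lambda>_. 0)"
      using that \<open>q \<ge> 2\<close> by (simp add: B_def fun_eq_iff)
    then show ?thesis
      using binomial_recurrence_solution[of d A "c j" i] rec[of j] start[of j] \<open>d \<ge> 2\<close> that
      by (auto simp: impulse_start_def)
  qed
  show ?thesis
    unfolding split_iff A_def[symmetric]
  proof (cases "b = 0")
    case True
    then show "(\<forall>j<d. c j (i * d) = (if j = 0 then 1 else 0))
        \<longleftrightarrow> (\<Prod>s<i. A (s * d)) = 1 \<and> b = 0"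
      using c[OF True] \<open>i < d\<close> by auto
  next
    case False
    then have "c i (i * d) \<noteq> (if i = 0 then 1 else 0)"
      using b \<open>1 \<le> i\<close> by auto
    then show "(\<forall>j<d. c j (i * d) = (if j = 0 then 1 else 0))
        \<longleftrightarrow> (\<Prod>s<i. A (s * d)) = 1 \<and> b = 0"
      using False \<open>i < d\<close> by blast
  qed
qed

text \<open>
  Write \<open>n = r + i * d\<close> with \<open>0 < r < d\<close>. Then \<open>i < d - 1\<close>, so the impulse at \<open>r\<close> is reached from \<open>n\<close> only
  by long steps and its value at \<open>n\<close> is a power of \<open>a\<close>. It has to vanish, so \<open>a = 0\<close>; but then the
  impulse at \<open>0\<close> cannot return to the value \<open>1\<close>.
\<close>
lemma not_splits_completely_if_not_dvd:
  fixes a b :: "'a::finite_field"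
  assumes q: "q = CHAR('a) ^ e" "q \<ge> 2" and card: "card (UNIV :: 'a set) = q ^ n"
    and "d \<ge> 2" "n \<ge> 1" "n \<le> (d - 1) * d" "\<not> d dvd n"
  shows "\<not> splits_completely q d (linearized_trinomial q d a b)"
proof
  assume split: "splits_completely q d (linearized_trinomial q d a b)"
  define A where "A m = a ^ q ^ m" for m
  define B where "B m = b ^ q ^ m" for m
  obtain c where rec: "\<And>j. trinomial_recurrence d A B (c j)"
    and start: "\<And>j. impulse_start d j 1 (c j)"
    using ex_impulse_solution[OF \<open>d \<ge> 2\<close>, of A B _ 1] by metis
  have "splits_completely q d (linearized_trinomial q d a b)
      \<longleftrightarrow> (\<forall>j<d. c j n = (if j = 0 then 1 else 0))"
    by (rule splits_completely_iff_impulse_period[OF q \<open>d \<ge> 2\<close> card])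
      (use rec start in \<open>auto simp: A_def[abs_def] B_def[abs_def]\<close>)
  then have period: "\<And>j. j < d \<Longrightarrow> c j n = (if j = 0 then 1 else 0)"
    using split by simp
  define i where "i = n div d"
  define r where "r = n mod d"
  have r: "r < d" "r \<noteq> 0" "n = r + i * d"
    using \<open>d \<ge> 2\<close> \<open>\<not> d dvd n\<close> by (auto simp: r_def i_def dvd_eq_mod_eq_0)
  have "i * d < (d - 1) * d"
    using r \<open>n \<le> _\<close> by linarith
  then have "i + 2 \<le> d"
    using \<open>d \<ge> 2\<close> by simp
  then have "c r n = (\<Prod>s<i. A (r + s * d))"
    using impulse_column[OF rec start \<open>r < d\<close>, of i] r by simp
  then have "a = 0"
    using period[OF \<open>r < d\<close>] r by (auto simp: A_def)
  then have "c 0 n = 0"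
    by (intro impulse_vanishes_if_A_zero[OF rec start \<open>d \<ge> 2\<close> _ \<open>n \<ge> 1\<close>])
      (use \<open>q \<ge> 2\<close> in \<open>simp add: A_def\<close>)
  then show False
    using period[of 0] \<open>d \<ge> 2\<close> by simp
qed

theorem theorem1p1:
  fixes q d n :: nat
  assumes "primepow q" and "d \<ge> 2" and "n \<ge> 1"
    and "card (UNIV :: 'a::finite_field set) = q ^ n"
  shows
    "(n \<le> (d - 1) * d \<and> \<not> d dvd n \<longrightarrow>
        \<not> (\<exists>a b :: 'a. splits_completely q d (linearized_trinomial q d a b)))
     \<and>
     (\<forall>i \<in> {1..d - 1}. n = i * d \<longrightarrow>
        (\<forall>a b :: 'a.
           splits_completely q d (linearized_trinomial q d a b) \<longleftrightarrow>
           a ^ (\<Sum>j = 0..i - 1. q ^ (j * d)) = 1 \<and> b = 0))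
     \<and>
     (n = (d - 1) * d + 1 \<longrightarrow>
        (\<forall>a b :: 'a.
           splits_completely q d (linearized_trinomial q d a b) \<longleftrightarrow>
           a ^ (\<Sum>j = 0..(d - 1) * d. q ^ j) = (- 1) ^ (d - 1) \<and>
           b = - (a ^ (q * (\<Sum>j = 0..d - 1. q ^ (j * d)))) \<and>
           (\<exists>k. d - 1 = CHAR('a) ^ k)))"
proof -
  obtain e where q: "q = CHAR('a) ^ e"
    using CHAR_power_if_card_power assms(1,4) by blast
  have "q \<ge> 2"
    using primepow_gt_Suc_0[OF assms(1)] by simp
  show ?thesis
  proof (intro conjI impI ballI allI)
    assume "n \<le> (d - 1) * d \<and> \<not> d dvd n"
    then show "\<not> (\<exists>a b :: 'a. splits_completely q d (linearized_trinomial q d a b))"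
      using not_splits_completely_if_not_dvd[OF q \<open>q \<ge> 2\<close> assms(4,2,3)] by blast
  next
    fix i and a b :: 'a
    assume i: "i \<in> {1..d - 1}" "n = i * d"
    have "{0..i - 1} = {..<i}"
      using i by auto
    then have "a ^ (\<Sum>j = 0..i - 1. q ^ (j * d)) = (\<Prod>s<i. a ^ q ^ (s * d))"
      by (simp add: power_sum)
    then show "splits_completely q d (linearized_trinomial q d a b) \<longleftrightarrow>
        a ^ (\<Sum>j = 0..i - 1. q ^ (j * d)) = 1 \<and> b = 0"
      using splits_completely_multiple_iff[OF q \<open>q \<ge> 2\<close>, of i d a b] assms i by simp
  next
    fix a b :: 'a
    assume n: "n = (d - 1) * d + 1"
    have "{0..(d - 1) * d} = {..<n}"
      using n by auto
    then have norm: "a ^ (\<Sum>j = 0..(d - 1) * d. q ^ j) = (\<Prod>v<n. a ^ q ^ v)"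
      by (simp add: power_sum)
    have "{0..d - 1} = {..<d}"
      using \<open>d \<ge> 2\<close> by auto
    then have "a ^ (q * (\<Sum>j = 0..d - 1. q ^ (j * d))) = (\<Prod>i<d. a ^ q ^ (1 + i * d))"
      by (simp add: sum_distrib_left power_sum)
    then show "splits_completely q d (linearized_trinomial q d a b) \<longleftrightarrow>
        a ^ (\<Sum>j = 0..(d - 1) * d. q ^ j) = (- 1) ^ (d - 1) \<and>
        b = - (a ^ (q * (\<Sum>j = 0..d - 1. q ^ (j * d)))) \<and>
        (\<exists>k. d - 1 = CHAR('a) ^ k)"
      using splits_completely_extremal_iff[OF q \<open>q \<ge> 2\<close> assms(4), of d "d - 1" a b] assms(2) n
      unfolding norm by simp
  qed
qed

end
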